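(* Let $x_1,\dots,x_{n+1}\in\mathbf{R}^n$ be the (affinely independent) vertices of a simplex (not necessarily regular) with centroid $x_0$, and let $f_0,f_1,\dots,f_{n+1}$ be the function values at the points $x_0,x_1,\dots,x_{n+1}$. Let $\nu_j=x_j-x_0$ for $j=1,\dots,n+1$ (so that $\nu_{n+1}=-\sum_{j=1}^n\nu_j$), let $V=\begin{bmatrix}\nu_1&\dots&\nu_n\end{bmatrix}\in\mathbf{R}^{n\times n}$ and $V_+=\begin{bmatrix}V&-Ve\end{bmatrix}\in\mathbf{R}^{n\times(n+1)}$, and let $\delta\mathbf{f}_+=(f_1-f_0,\dots,f_{n+1}-f_0)^T\in\mathbf{R}^{n+1}$. Let $h>0$ be a fixed scalar. Then the simplex gradient $g$, defined as the solution of $$V_+V_+^Tg=\tfrac1hV_+\delta\mathbf{f}_+,$$ is independent of $f_0$; that is, for fixed $x_1,\dots,x_{n+1}$, $h$ and $f_1,\dots,f_{n+1}$, the vector $g$ is the same for every value of $f_0\in\mathbf{R}$.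
   Context: $e$ denotes the all-ones vector of appropriate size. The displayed equations are the normal equations of the least-squares problem for the system $V_+^Tg=\frac1h\delta\mathbf{f}_+$; with the unnormalized arms $\nu_j$, the choice $h=1$ gives the least-squares solution of $(x_j-x_0)^Tg=f_j-f_0$, $j=1,\dots,n+1$. The centroid of $x_1,\dots,x_{n+1}$ is $x_0=\frac{1}{n+1}\sum_{j=1}^{n+1}x_j$. *)

theory Defs
  imports "HOL-Analysis.Analysis"
begin

text \<open>
  The ambient space is \<open>real ^ 'n\<close>, with \<open>n = CARD('n) \<ge> 1\<close>. The vertices
  \<open>x\<^sub>1, \<dots>, x\<^sub>n, x\<^sub>n\<^sub>+\<^sub>1\<close> are indexed by \<open>'n option\<close>, which has \<open>n + 1\<close> elements:
  \<open>Some j\<close> stands for one of the first \<open>n\<close> indices and \<open>None\<close> for the index \<open>n + 1\<close>.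
\<close>

definition simplex_vertices :: "('n::finite option \<Rightarrow> real ^ 'n) \<Rightarrow> bool" where
  "simplex_vertices x \<longleftrightarrow> inj x \<and> \<not> affine_dependent (range x)"

definition centroid :: "('n::finite option \<Rightarrow> real ^ 'n) \<Rightarrow> real ^ 'n" where
  "centroid x = (1 / (real CARD('n) + 1)) *\<^sub>R (\<Sum>j\<in>UNIV. x j)"

definition arm :: "('n::finite option \<Rightarrow> real ^ 'n) \<Rightarrow> 'n option \<Rightarrow> real ^ 'n" where
  "arm x j = x j - centroid x"

definition ones :: "real ^ 'n::finite" where
  "ones = (\<chi> i. 1)"

definition V_mat :: "('n::finite option \<Rightarrow> real ^ 'n) \<Rightarrow> real ^ 'n ^ 'n" where
  "V_mat x = (\<chi> i j. arm x (Some j) $ i)"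

definition V_plus :: "('n::finite option \<Rightarrow> real ^ 'n) \<Rightarrow> real ^ ('n option) ^ 'n" where
  "V_plus x = (\<chi> i k. case k of Some j \<Rightarrow> V_mat x $ i $ j | None \<Rightarrow> (- (V_mat x *v ones)) $ i)"

definition delta_f :: "real \<Rightarrow> ('n::finite option \<Rightarrow> real) \<Rightarrow> real ^ ('n option)" where
  "delta_f f0 f = (\<chi> k. f k - f0)"

definition normal_equations ::
  "('n::finite option \<Rightarrow> real ^ 'n) \<Rightarrow> real \<Rightarrow> real \<Rightarrow> ('n option \<Rightarrow> real) \<Rightarrow> real ^ 'n \<Rightarrow> bool" where
  "normal_equations x h f0 f g \<longleftrightarrow>
     (V_plus x ** transpose (V_plus x)) *v g = (1 / h) *\<^sub>R (V_plus x *v delta_f f0 f)"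

definition simplex_gradient ::
  "('n::finite option \<Rightarrow> real ^ 'n) \<Rightarrow> real \<Rightarrow> real \<Rightarrow> ('n option \<Rightarrow> real) \<Rightarrow> real ^ 'n" where
  "simplex_gradient x h f0 f = (THE g. normal_equations x h f0 f g)"

text \<open>The last column of \<open>V_plus x\<close> is the remaining arm.\<close>

lemma sum_UNIV_option:
  fixes F :: "'n::finite option \<Rightarrow> 'b::comm_monoid_add"
  shows "(\<Sum>k\<in>UNIV. F k) = F None + (\<Sum>j\<in>UNIV. F (Some j))"
  by (simp add: UNIV_option_conv sum.reindex)

lemma arm_None: "arm x None = - (\<Sum>j\<in>UNIV. arm x (Some j))"
proof -
  have "(\<Sum>k\<in>UNIV. arm x k) = 0"
    by (simp add: vec_eq_iff arm_def centroid_def sum_subtractf of_nat_index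
        nonzero_eq_divide_eq add.commute add_pos_nonneg[THEN less_imp_neq, symmetric])
  then show ?thesis
    by (simp add: sum_UNIV_option add_eq_0_iff2)
qed

lemma column_V_plus: "column k (V_plus x) = arm x k"
  by (cases k)
    (simp_all add: column_def V_plus_def V_mat_def ones_def matrix_vector_mult_def
      vec_eq_iff arm_None sum_negf)

end

theory Submission
  imports Defs
begin

text \<open>
  The arms sum to zero, so \<open>f0\<close>, which enters \<open>delta_f\<close> as a multiple of the all-ones vector,
  cancels from the right-hand side. The Gram matrix is nonsingular because a vector orthogonal to
  all arms has constant inner product with the vertices, hence with their affine hull, which is
  the whole space.
\<close>

lemma sum_arm: "(\<Sum>k\<in>UNIV. arm x k) = 0"
  by (simp add: sum_UNIV_option arm_None)

text \<open>The product is a combination of the columns, which are the arms; \<open>f0\<close>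
  multiplies only their sum, zero by \<open>sum_arm\<close>.\<close>

lemma V_plus_mult_delta_f: "V_plus x *v delta_f f0 f = (\<Sum>k\<in>UNIV. f k *\<^sub>R arm x k)"
proof -
  have "V_plus x *v delta_f f0 f = (\<Sum>k\<in>UNIV. (f k - f0) *\<^sub>R arm x k)"
    by (simp add: matrix_mult_sum column_V_plus delta_f_def scalar_mult_eq_scaleR)
  also have "\<dots> = (\<Sum>k\<in>UNIV. f k *\<^sub>R arm x k) - f0 *\<^sub>R (\<Sum>k\<in>UNIV. arm x k)"
    by (simp add: scaleR_diff_left sum_subtractf scaleR_sum_right)
  finally show ?thesis
    by (simp add: sum_arm)
qed

lemma orthogonal_arms_imp_zero:
  fixes x :: "'n::finite option \<Rightarrow> real ^ 'n"
  assumes "simplex_vertices x" and "\<And>k. arm x k \<bullet> g = 0"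
  shows "g = 0"
proof -
  \<comment> \<open>Injectivity of \<open>x\<close> yields n + 1 distinct points, as many as an
    affinely independent set needs to span the space.\<close>
  have "card (range x) = Suc DIM(real ^ 'n)"
    using assms(1) by (simp add: simplex_vertices_def card_image)
  then have hull: "affine hull range x = UNIV"
    using assms(1) by (intro affine_independent_span_eq) (simp_all add: simplex_vertices_def)
  have "range x \<subseteq> {y. g \<bullet> y = g \<bullet> centroid x}"
    using assms(2) by (auto simp: arm_def inner_diff_right inner_commute)
  then have "affine hull range x \<subseteq> {y. g \<bullet> y = g \<bullet> centroid x}"
    by (intro hull_minimal affine_hyperplane)
  \<comment> \<open>Testing the hyperplane at this point leaves
    \<open>g \<bullet> g = 0\<close>.\<close>
  then have "g \<bullet> (centroid x + g) = g \<bullet> centroid x"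
    unfolding hull by blast
  then show "g = 0"
    by (simp add: inner_add_right)
qed

lemma bij_gram_V_plus:
  assumes "simplex_vertices x"
  shows "bij ((*v) (V_plus x ** transpose (V_plus x)))"
proof -
  let ?G = "V_plus x ** transpose (V_plus x)"
  have "g = 0" if "?G *v g = 0" for g
  proof (rule orthogonal_arms_imp_zero[OF assms])
    fix k
    \<comment> \<open>The quadratic form of the Gram matrix is a squared norm, so its kernel is that
      of the transpose, whose rows are the arms.\<close>
    have "(transpose (V_plus x) *v g) \<bullet> (transpose (V_plus x) *v g) = g \<bullet> (?G *v g)"
      by (simp add: dot_lmul_matrix[symmetric] matrix_vector_mul_assoc[symmetric])
    then have "(transpose (V_plus x) *v g) $ k = 0"
      using that by simp
    then show "arm x k \<bullet> g = 0"
      by (simp add: matrix_vector_mul_component row_transpose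
          column_V_plus[symmetric] column_def transpose_def)
  qed
  then have "inj ((*v) ?G)"
    by (simp add: linear_injective_0)
  then show ?thesis
    by (simp add: bij_def linear_injective_imp_surjective)
qed

theorem theorem2:
  fixes x :: "'n::finite option \<Rightarrow> real ^ 'n" and h :: real and f :: "'n option \<Rightarrow> real"
  assumes "simplex_vertices x" and "h > 0"
  shows "(\<forall>f0. \<exists>!g. normal_equations x h f0 f g) \<and>
         (\<forall>f0 f0'. simplex_gradient x h f0 f = simplex_gradient x h f0' f)"
proof (intro conjI allI)
  fix f0
  show "\<exists>!g. normal_equations x h f0 f g"
    using bij_gram_V_plus[OF assms(1)] unfolding normal_equations_def bij_iff by blast
next
  fix f0 f0'
  show "simplex_gradient x h f0 f = simplex_gradient x h f0' f"
    \<comment> \<open>Once \<open>f0\<close> has cancelled, both sides are the same definite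
      description.\<close>
    by (simp only: simplex_gradient_def normal_equations_def V_plus_mult_delta_f)
qed

end
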